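(* Let $\ell \geq 1$ and $n \geq \ell + 1$ be integers, let $k = n^2 -2\ell + 4$, and let $v = k^2 - k + 2\ell$. 1. If $v \equiv 0 \pmod 8$ and $k-2$ is not the sum of two squares, then a $(v,k)$-modular Golomb ruler does not exist. 2. If $v \equiv 4 \pmod 8$ and $k$ is not the sum of two squares, then a $(v,k)$-modular Golomb ruler does not exist.
   Context: For an integer $k\ge 3$ and a positive integer $v$, a $(v,k)$-modular Golomb ruler ($(v,k)$-MGR) is a set of $k$ distinct integers $0 \leq x_1 < x_2 < \cdots < x_k \leq v-1$ such that all the differences $x_j - x_i \bmod v$ (over ordered pairs $(i,j)$ with $i \neq j$) are distinct elements of $\mathbb{Z}_v$. Squares are squares of integers ($0$ allowed). *)

theory Defs
  imports "HOL-Number_Theory.Cong"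
begin

text \<open>
  A modular Golomb ruler is given by its underlying set of integers rather than by the increasing
  enumeration of it. Distinctness of the differences modulo \<open>v\<close> is injectivity on the ordered
  pairs of distinct elements; an element of \<open>\<int>\<^sub>v\<close> is represented by its residue in \<open>{0..v - 1}\<close>.
\<close>

definition modular_golomb_ruler :: "int \<Rightarrow> int \<Rightarrow> int set \<Rightarrow> bool" where
  "modular_golomb_ruler v k X \<longleftrightarrow>
     k \<ge> 3 \<and> v > 0 \<and> X \<subseteq> {0..v - 1} \<and> int (card X) = k \<and>
     inj_on (\<lambda>(x, y). (y - x) mod v) {(x, y). x \<in> X \<and> y \<in> X \<and> x \<noteq> y}"

definition sum_of_two_squares :: "int \<Rightarrow> bool" where
  "sum_of_two_squares m \<longleftrightarrow> (\<exists>a b :: int. m = a\<^sup>2 + b\<^sup>2)"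

end

theory Submission
  imports Defs
begin

text \<open>
  Let \<open>X\<close> be a \<open>(v, k)\<close>-modular Golomb ruler and \<open>L\<close> the set of residues modulo \<open>v\<close> that are not
  differences of distinct elements of \<open>X\<close>. Every residue outside \<open>L\<close> is a difference exactly once,
  so for a function \<open>f\<close> on \<open>\<int>\<^sub>v\<close> with total sum \<open>0\<close> the sum of \<open>f (y - x)\<close> over all
  \<open>x, y \<in> X\<close> is \<open>k * f 0 - (\<Sum>d\<in>L. f d)\<close>; this is the case of total sum \<open>0\<close> in
  \<open>sum_differences\<close>. Counting gives \<open>card L = v - k\<^sup>2 + k = 2 * l\<close>. Let \<open>4\<close> divide \<open>v\<close>; then \<open>L\<close>
  contains the even residues \<open>0\<close> and \<open>v div 2\<close>. The latter is its own negative modulo \<open>v\<close>, so as a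
  difference of \<open>x\<close> and \<open>y\<close> it would also be one of \<open>y\<close> and \<open>x\<close>.

  Take for \<open>f\<close> the character of order two, \<open>(-1)\<^sup>d\<close>. If \<open>L\<close> has \<open>e\<close> even elements, the identity
  says that \<open>k + 2 * l - 2 * e = n\<^sup>2 + 4 - 2 * e\<close> is a square. Here \<open>2 \<le> e \<le> 2 * l\<close> and \<open>l < n\<close>,
  so this square lies strictly above \<open>(n - 2)\<^sup>2\<close>, is at most \<open>n\<^sup>2\<close>, and has the parity of \<open>n\<^sup>2\<close>. Hence it
  equals \<open>n\<^sup>2\<close>, \<open>e = 2\<close>, and \<open>0\<close> and \<open>v div 2\<close> are the only even elements of \<open>L\<close>; this is
  \<open>even_missing_differences\<close>.

  Now take for \<open>f\<close> the real part of a character of order four. It vanishes at odd numbers, so the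
  right-hand side is \<open>k - f 0 - f (v div 2)\<close>, which is \<open>k - 2\<close> or \<open>k\<close> according to \<open>v mod 8\<close>, while
  the left-hand side is the squared absolute value of a Gaussian integer, a sum of two squares.
\<close>

section \<open>Missing differences of a modular Golomb ruler\<close>

text \<open>
  The residues modulo \<open>v\<close>, in \<open>{0..<v}\<close>, that are not a difference of two distinct elements of \<open>X\<close>.
  For a ruler \<open>X\<close> the residue \<open>0\<close> is among them.
\<close>

definition missing_differences :: "int \<Rightarrow> int set \<Rightarrow> int set" where
  "missing_differences v X =
     {0..<v} - (\<lambda>(x, y). (y - x) mod v) ` {(x, y). x \<in> X \<and> y \<in> X \<and> x \<noteq> y}"

lemma finite_missing_differences [simp]: "finite (missing_differences v X)"
  by (simp add: missing_differences_def)

lemma modular_golomb_ruler_finite: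
  assumes "modular_golomb_ruler v k X"
  shows "finite X"
  using assms finite_subset unfolding modular_golomb_ruler_def by blast

text \<open>The group ring identity \<open>X X\<^sup>-\<^sup>1 = k + \<int>\<^sub>v - L\<close>, tested against a \<open>v\<close>-periodic function.\<close>

lemma sum_differences:
  fixes f :: "int \<Rightarrow> int"
  assumes X: "modular_golomb_ruler v k X" and periodic: "\<And>d. f (d mod v) = f d"
  shows "(\<Sum>x\<in>X. \<Sum>y\<in>X. f (y - x))
       = k * f 0 + (\<Sum>d=0..<v. f d) - (\<Sum>d\<in>missing_differences v X. f d)"
proof -
  define P where "P = {(x, y). x \<in> X \<and> y \<in> X \<and> x \<noteq> y}"
  define g where "g = (\<lambda>(x::int, y). (y - x) mod v)"
  have fin: "finite X" using X by (rule modular_golomb_ruler_finite)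
  have inj: "inj_on g P" and v: "v > 0" and card: "int (card X) = k"
    using X unfolding modular_golomb_ruler_def P_def g_def by auto
  have finP: "finite P"
    using fin by (auto simp: P_def intro: finite_subset[of _ "X \<times> X"])
  have sub: "g ` P \<subseteq> {0..<v}"
    using v by (auto simp: g_def)
  have diag: "X \<times> X = P \<union> (\<lambda>x. (x, x)) ` X"
    by (auto simp: P_def)
  have "(\<Sum>x\<in>X. \<Sum>y\<in>X. f (y - x)) = (\<Sum>(x, y)\<in>X \<times> X. f (y - x))"
    by (simp add: sum.cartesian_product)
  also have "\<dots> = (\<Sum>(x, y)\<in>P. f (y - x)) + (\<Sum>(x, y)\<in>(\<lambda>x. (x, x)) ` X. f (y - x))"
    unfolding diag
    by (rule sum.union_disjoint[OF finP finite_imageI[OF fin]]) (auto simp: P_def)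
  also have "(\<Sum>(x, y)\<in>(\<lambda>x. (x, x)) ` X. f (y - x)) = k * f 0"
    by (subst sum.reindex) (auto simp: inj_on_def card)
  also have "(\<Sum>(x, y)\<in>P. f (y - x)) = (\<Sum>d\<in>g ` P. f d)"
    by (subst sum.reindex[OF inj]) (auto simp: g_def periodic intro!: sum.cong)
  also have "\<dots> = (\<Sum>d=0..<v. f d) - (\<Sum>d\<in>missing_differences v X. f d)"
    using sum.subset_diff[OF sub, of f]
    by (simp add: missing_differences_def P_def g_def)
  finally show ?thesis by simp
qed

lemma card_missing_differences:
  assumes "modular_golomb_ruler v k X"
  shows "int (card (missing_differences v X)) = v - k\<^sup>2 + k"
proof -
  have "int (card X) = k" "v > 0"
    using assms by (auto simp: modular_golomb_ruler_def)
  thus ?thesis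
    using sum_differences[OF assms, of "\<lambda>_. 1"] by (simp add: power2_eq_square)
qed

lemma zero_in_missing_differences:
  assumes "modular_golomb_ruler v k X"
  shows "0 \<in> missing_differences v X"
proof -
  have "(y - x) mod v \<noteq> 0" if "x \<in> X" "y \<in> X" "x \<noteq> y" for x y
  proof
    assume "(y - x) mod v = 0"
    hence "y mod v = x mod v"
      by (simp add: mod_eq_dvd_iff mod_eq_0_iff_dvd)
    moreover have "0 \<le> x" "x < v" "0 \<le> y" "y < v"
      using assms that by (auto simp: modular_golomb_ruler_def)
    ultimately show False using that by simp
  qed
  thus ?thesis
    using assms by (force simp: missing_differences_def modular_golomb_ruler_def)
qed

lemma half_in_missing_differences:
  assumes X: "modular_golomb_ruler v k X" and "even v"
  shows "v div 2 \<in> missing_differences v X"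
proof -
  obtain h where h: "v = 2 * h" using \<open>even v\<close> by (elim evenE)
  have v: "v > 0" using X by (simp add: modular_golomb_ruler_def)
  have "(y - x) mod v \<noteq> h" if xy: "x \<in> X" "y \<in> X" "x \<noteq> y" for x y
  proof
    assume eq: "(y - x) mod v = h"
    have "(x - y) mod v = (- ((y - x) mod v)) mod v"
      by (simp add: mod_minus_eq)
    also have "\<dots> = (- h + v) mod v"
      unfolding eq by simp
    also have "\<dots> = h" using h v by simp
    finally have "(y - x) mod v = (x - y) mod v" using eq by simp
    moreover have "inj_on (\<lambda>(x, y). (y - x) mod v) {(x, y). x \<in> X \<and> y \<in> X \<and> x \<noteq> y}"
      using X by (simp add: modular_golomb_ruler_def)
    ultimately have "(x, y) = (y, x)"
      using xy by (auto dest!: inj_onD[where x = "(x, y)" and y = "(y, x)"])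
    thus False using xy by simp
  qed
  thus ?thesis
    using h v by (force simp: missing_differences_def)
qed

section \<open>Characters of order two and four\<close>

text \<open>The character of order two and the real part of the character \<open>d \<mapsto> \<i>\<^sup>d\<close> of order four.\<close>

definition chi2 :: "int \<Rightarrow> int" where
  "chi2 d = (if even d then 1 else -1)"

definition re_chi4 :: "int \<Rightarrow> int" where
  "re_chi4 d = (if d mod 4 = 0 then 1 else if d mod 4 = 2 then -1 else 0)"

lemma chi2_diff: "chi2 (y - x) = chi2 x * chi2 y"
  by (simp add: chi2_def)

text \<open>
  The real part of \<open>\<i>\<^sup>y\<close> times the conjugate of \<open>\<i>\<^sup>x\<close>, where the imaginary part of a power \<open>\<i>\<^sup>d\<close> is
  written as the real part of the power with exponent \<open>d - 1\<close>.
\<close>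

lemma re_chi4_diff:
  "re_chi4 (y - x) = re_chi4 x * re_chi4 y + re_chi4 (x - 1) * re_chi4 (y - 1)"
proof -
  have *: "(y - x) mod 4 = (y mod 4 - x mod 4) mod 4"
    "(x - 1) mod 4 = (x mod 4 - 1) mod 4" "(y - 1) mod 4 = (y mod 4 - 1) mod 4"
    by (simp_all only: mod_diff_left_eq mod_diff_right_eq)
  have "x mod 4 = 0 \<or> x mod 4 = 1 \<or> x mod 4 = 2 \<or> x mod 4 = 3"
    "y mod 4 = 0 \<or> y mod 4 = 1 \<or> y mod 4 = 2 \<or> y mod 4 = 3"
    by presburger+
  thus ?thesis
    unfolding re_chi4_def * by (elim disjE) simp_all
qed

lemma chi2_mod: "even v \<Longrightarrow> chi2 (d mod v) = chi2 d"
  by (simp add: chi2_def dvd_mod_iff)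

lemma re_chi4_mod: "4 dvd v \<Longrightarrow> re_chi4 (d mod v) = re_chi4 d"
  by (simp add: re_chi4_def mod_mod_cancel)

lemma sum_four_consecutive:
  fixes f :: "int \<Rightarrow> int"
  assumes "4 dvd v" "v \<ge> 0" "\<And>d. f (4 * d) + f (4 * d + 1) + f (4 * d + 2) + f (4 * d + 3) = 0"
  shows "(\<Sum>d=0..<v. f d) = 0"
proof -
  have "(\<Sum>d=0..<4 * int m. f d) = 0" for m
  proof (induction m)
    case (Suc m)
    have "{0..<4 * int (Suc m)} = {0..<4 * int m} \<union>
            {4 * int m, 4 * int m + 1, 4 * int m + 2, 4 * int m + 3}"
      by auto
    also have "(\<Sum>d\<in>\<dots>. f d) = (\<Sum>d=0..<4 * int m. f d) +
            (\<Sum>d\<in>{4 * int m, 4 * int m + 1, 4 * int m + 2, 4 * int m + 3}. f d)"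
      by (rule sum.union_disjoint) auto
    finally show ?case using Suc assms(3)[of "int m"] by (simp add: add.assoc)
  qed simp
  moreover have "v = 4 * int (nat (v div 4))" using assms(1,2) by auto
  ultimately show ?thesis by metis
qed

lemma sum_chi2_eq_0: "4 dvd v \<Longrightarrow> v \<ge> 0 \<Longrightarrow> (\<Sum>d=0..<v. chi2 d) = 0"
  by (rule sum_four_consecutive) (simp_all add: chi2_def)

lemma sum_re_chi4_eq_0: "4 dvd v \<Longrightarrow> v \<ge> 0 \<Longrightarrow> (\<Sum>d=0..<v. re_chi4 d) = 0"
proof (rule sum_four_consecutive)
  fix d :: int
  have "4 * d mod 4 = 0" "(4 * d + 1) mod 4 = 1" "(4 * d + 2) mod 4 = 2" "(4 * d + 3) mod 4 = 3"
    by presburger+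
  thus "re_chi4 (4 * d) + re_chi4 (4 * d + 1) + re_chi4 (4 * d + 2) + re_chi4 (4 * d + 3) = 0"
    by (simp add: re_chi4_def)
qed

lemma sum_chi2:
  assumes "finite A"
  shows "(\<Sum>d\<in>A. chi2 d) = 2 * int (card {d\<in>A. even d}) - int (card A)"
proof -
  have "(\<Sum>d\<in>A. chi2 d) = (\<Sum>d\<in>A. 2 * (if even d then 1 else 0) - 1)"
    by (intro sum.cong) (auto simp: chi2_def)
  also have "\<dots> = 2 * (\<Sum>d\<in>A. if even d then 1 else 0) - int (card A)"
    by (simp add: sum_subtractf sum_distrib_left)
  also have "(\<Sum>d\<in>A. if even d then 1 else 0) = int (card {d\<in>A. even d})"
    using assms by (simp add: sum.If_cases Int_def)
  finally show ?thesis .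
qed

text \<open>
  For a nontrivial character \<open>\<chi>\<close> and the set \<open>L\<close> of missing differences, the group ring identity
  gives \<open>\<bar>\<chi> X\<bar>\<^sup>2 = k - \<chi> L\<close>. The next two lemmas are the real parts of this for the orders two
  and four.
\<close>

lemma square_eq_chi2:
  assumes X: "modular_golomb_ruler v k X" and "4 dvd v"
  shows "(\<Sum>x\<in>X. chi2 x)\<^sup>2 = k - (\<Sum>d\<in>missing_differences v X. chi2 d)"
proof -
  have "even v" using \<open>4 dvd v\<close> by presburger
  have v: "v > 0" using X by (simp add: modular_golomb_ruler_def)
  have "(\<Sum>x\<in>X. chi2 x)\<^sup>2 = (\<Sum>x\<in>X. \<Sum>y\<in>X. chi2 (y - x))"
    by (simp add: power2_eq_square sum_product chi2_diff)
  also have "\<dots> = k * chi2 0 - (\<Sum>d\<in>missing_differences v X. chi2 d)"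
    using sum_differences[OF X, of chi2] chi2_mod[OF \<open>even v\<close>] sum_chi2_eq_0[OF \<open>4 dvd v\<close>] v
    by simp
  finally show ?thesis by (simp add: chi2_def)
qed

lemma sum_of_two_squares_re_chi4:
  assumes X: "modular_golomb_ruler v k X" and "4 dvd v"
  shows "sum_of_two_squares (k - (\<Sum>d\<in>missing_differences v X. re_chi4 d))"
proof -
  have v: "v > 0" using X by (simp add: modular_golomb_ruler_def)
  have "(\<Sum>x\<in>X. re_chi4 x)\<^sup>2 + (\<Sum>x\<in>X. re_chi4 (x - 1))\<^sup>2
      = (\<Sum>x\<in>X. \<Sum>y\<in>X. re_chi4 x * re_chi4 y + re_chi4 (x - 1) * re_chi4 (y - 1))"
    by (simp only: power2_eq_square sum_product sum.distrib)
  also have "\<dots> = (\<Sum>x\<in>X. \<Sum>y\<in>X. re_chi4 (y - x))"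
    by (intro sum.cong refl re_chi4_diff[symmetric])
  also have "\<dots> = k * re_chi4 0 - (\<Sum>d\<in>missing_differences v X. re_chi4 d)"
    using sum_differences[OF X, of re_chi4] re_chi4_mod[OF \<open>4 dvd v\<close>]
      sum_re_chi4_eq_0[OF \<open>4 dvd v\<close>] v
    by simp
  finally show ?thesis
    unfolding sum_of_two_squares_def by (auto simp: re_chi4_def intro: sym)
qed

section \<open>Even missing differences\<close>

lemma square_between_eq:
  fixes s n :: int
  assumes "n \<ge> 2" "(n - 2)\<^sup>2 < s\<^sup>2" "s\<^sup>2 \<le> n\<^sup>2" "even (s\<^sup>2) \<longleftrightarrow> even (n\<^sup>2)"
  shows "s\<^sup>2 = n\<^sup>2"
proof -
  have "\<bar>n - 2\<bar> < \<bar>s\<bar>" "\<bar>s\<bar> \<le> \<bar>n\<bar>"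
    using assms(2,3) by (simp_all only: abs_le_square_iff not_le[symmetric] simp_thms)
  moreover have "even s \<longleftrightarrow> even n" using assms by simp
  ultimately have "\<bar>s\<bar> = n" using \<open>n \<ge> 2\<close> by presburger
  thus ?thesis by (metis power2_abs)
qed

lemma even_missing_differences:
  fixes l n k v :: int
  assumes "l \<ge> 1" "n \<ge> l + 1" and k: "k = n\<^sup>2 - 2 * l + 4" and v: "v = k\<^sup>2 - k + 2 * l"
    and X: "modular_golomb_ruler v k X" and "4 dvd v"
  shows "{d \<in> missing_differences v X. even d} = {0, v div 2}"
proof -
  define L where "L = missing_differences v X"
  define E where "E = {d \<in> L. even d}"
  have finL: "finite L" and finE: "finite E" by (simp_all add: L_def E_def)
  have "v > 0" using X by (simp add: modular_golomb_ruler_def)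
  have "even v" "even (v div 2)" using \<open>4 dvd v\<close> by presburger+
  hence sub: "{0, v div 2} \<subseteq> E"
    using zero_in_missing_differences[OF X] half_in_missing_differences[OF X]
    by (simp add: E_def L_def)
  have card2: "card {0, v div 2} = 2" using \<open>v > 0\<close> \<open>even v\<close> by auto
  have cardL: "int (card L) = 2 * l"
    using card_missing_differences[OF X] v by (simp add: L_def)
  have "int (card E) \<ge> 2"
    using card_mono[OF finE sub] card2 by simp
  moreover have "int (card E) \<le> 2 * l"
    using card_mono[OF finL, of E] cardL by (simp add: E_def)
  moreover have sq: "(\<Sum>x\<in>X. chi2 x)\<^sup>2 = n\<^sup>2 + 4 - 2 * int (card E)"
    using square_eq_chi2[OF X \<open>4 dvd v\<close>] sum_chi2[OF finL] cardL k by (simp add: L_def E_def)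
  moreover have "(n - 2)\<^sup>2 = n\<^sup>2 - 4 * n + 4"
    by (simp add: power2_eq_square algebra_simps)
  ultimately have "(\<Sum>x\<in>X. chi2 x)\<^sup>2 = n\<^sup>2"
    using assms(1,2) by (intro square_between_eq) (linarith, linarith, linarith, simp)
  hence "card E = 2" using sq by simp
  thus ?thesis
    using card_subset_eq[OF finE sub] card2 by (simp add: E_def L_def)
qed

text \<open>\<open>re_chi4 (v div 2)\<close> is \<open>1\<close> for \<open>v\<close> divisible by \<open>8\<close> and \<open>-1\<close> otherwise.\<close>

lemma sum_of_two_squares_if_ruler:
  fixes l n k v :: int
  assumes "l \<ge> 1" "n \<ge> l + 1" "k = n\<^sup>2 - 2 * l + 4" "v = k\<^sup>2 - k + 2 * l"
    and X: "modular_golomb_ruler v k X" and "4 dvd v"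
  shows "sum_of_two_squares (k - 1 - re_chi4 (v div 2))"
proof -
  define L where "L = missing_differences v X"
  have "v > 0" using X by (simp add: modular_golomb_ruler_def)
  have "v div 2 \<noteq> 0" using \<open>v > 0\<close> \<open>4 dvd v\<close> by presburger
  have "re_chi4 d = 0" if "odd d" for d
    using that unfolding re_chi4_def by presburger
  hence "(\<Sum>d\<in>L. re_chi4 d) = (\<Sum>d\<in>{d \<in> L. even d}. re_chi4 d)"
    by (intro sum.mono_neutral_right) (auto simp: L_def)
  also have "\<dots> = 1 + re_chi4 (v div 2)"
    unfolding L_def even_missing_differences[OF assms]
    using \<open>v div 2 \<noteq> 0\<close> by (simp add: re_chi4_def)
  finally show ?thesis
    using sum_of_two_squares_re_chi4[OF X \<open>4 dvd v\<close>] by (simp add: L_def diff_diff_eq)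
qed

theorem corollary3p12:
  fixes l n k v :: int
  assumes "l \<ge> 1" and "n \<ge> l + 1"
    and "k = n\<^sup>2 - 2 * l + 4"
    and "v = k\<^sup>2 - k + 2 * l"
  shows "([v = 0] (mod 8) \<and> \<not> sum_of_two_squares (k - 2) \<longrightarrow> (\<nexists>X. modular_golomb_ruler v k X))
       \<and> ([v = 4] (mod 8) \<and> \<not> sum_of_two_squares k \<longrightarrow> (\<nexists>X. modular_golomb_ruler v k X))"
proof -
  have "sum_of_two_squares (k - 2)" if "[v = 0] (mod 8)" "modular_golomb_ruler v k X" for X
  proof -
    have "v mod 8 = 0" using that(1) by (simp add: cong_def)
    hence "4 dvd v" "(v div 2) mod 4 = 0" by presburger+
    thus ?thesis
      using sum_of_two_squares_if_ruler[OF assms that(2)] by (simp add: re_chi4_def)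
  qed
  moreover have "sum_of_two_squares k" if "[v = 4] (mod 8)" "modular_golomb_ruler v k X" for X
  proof -
    have "v mod 8 = 4" using that(1) by (simp add: cong_def)
    hence "4 dvd v" "(v div 2) mod 4 = 2" by presburger+
    thus ?thesis
      using sum_of_two_squares_if_ruler[OF assms that(2)] by (simp add: re_chi4_def)
  qed
  ultimately show ?thesis by blast
qed

end
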